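(* Let $\mathcal X_0,\mathcal X_1,\mathcal D,\mathcal D_*$ be linear spaces and let $$U_0=\begin{bmatrix}A_0&B_0\\ C_0&D_0\end{bmatrix}:\begin{bmatrix}\mathcal X_0\\ \mathcal D\end{bmatrix}\to\begin{bmatrix}\mathcal X_0\\ \mathcal D_*\end{bmatrix},\qquad U_1=\begin{bmatrix}A_1&B_1\\ C_1&D_1\end{bmatrix}:\begin{bmatrix}\mathcal X_1\\ \mathcal D_*\end{bmatrix}\to\begin{bmatrix}\mathcal X_1\\ \mathcal D\end{bmatrix}$$ be two colligation matrices such that $I-D_1D_0$ is invertible on $\mathcal D$. Set $U=\mathcal F_\ell(U_0,U_1)\in\mathcal L(\mathcal X_0\oplus\mathcal X_1)$. Then the trajectory-level feedback connection operator $\mathcal F_\ell(\mathbf W(U_0)^+,\mathbf W(U_1)^+)$ computes the powers of $U$: $$\Lambda_{\mathcal X_0\oplus\mathcal X_1,+}(U)=\mathcal F_\ell(\mathbf W(U_0)^+,\mathbf W(U_1)^+):\mathcal X_0\oplus\mathcal X_1\to\ell_{\mathcal X_0\oplus\mathcal X_1}(\mathbb Z_+).$$ Hence, after the natural identification of $\ell_{\mathcal X_0\oplus\mathcal X_1}(\mathbb Z_+)$ with $\ell_{\mathcal X_0}(\mathbb Z_+)\oplus\ell_{\mathcal X_1}(\mathbb Z_+)$, the entries of the $2\times2$ block matrix $\Lambda_{\mathcal X_0\oplus\mathcal X_1,+}(U)=[\Lambda_{ij}]_{i,j=1,2}$, $\Lambda_{ij}:\mathcal X_{j-1}\to\ell_{\mathcal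 X_{i-1}}(\mathbb Z_+)$, are $$\begin{aligned} \Lambda_{11}&=W(U_0)_0^++W(U_0)_2^+(I-W(U_1)^+W(U_0)^+)^{-1}W(U_1)^+W(U_0)_1^+,\\ \Lambda_{12}&=W(U_0)_2^+(I-W(U_1)^+W(U_0)^+)^{-1}W(U_1)_1^+,\\ \Lambda_{21}&=W(U_1)_2^+(I-W(U_0)^+W(U_1)^+)^{-1}W(U_0)_1^+,\\ \Lambda_{22}&=W(U_1)_0^++W(U_1)_2^+(I-W(U_0)^+W(U_1)^+)^{-1}W(U_0)^+W(U_1)_1^+. \end{aligned}$$
   Context: For a linear space $\mathcal G$, $\ell_{\mathcal G}(\mathbb Z_+)$ is the space of all $\mathcal G$-valued functions on $\mathbb Z_+=\{0,1,2,\dots\}$. Fourier representation operator: for a linear operator $U$ on $\mathcal K$, $\Lambda_{\mathcal K,+}(U):\mathcal K\to\ell_{\mathcal K}(\mathbb Z_+)$, $k\mapsto\{U^nk\}_{n\in\mathbb Z_+}$. Feedback connection: for linear operators $U_0:\mathcal X_0\oplus\mathcal F\to\widetilde{\mathcal X}_0\oplus\mathcal F_*$ and $U_1:\mathcal X_1\oplus\mathcal F_*\to\widetilde{\mathcal X}_1\oplus\mathcal F$ one sets $\mathcal F_\ell(U_0,U_1)\begin{bmatrix}x_0\\ x_1\end{bmatrix}=\begin{bmatrix}\widetilde x_0\\ \widetilde x_1\end{bmatrix}$ if there exist $f\in\mathcal F$, $f_*\in\mathcal F_*$ with $U_0\begin{bmatrix}x_0\\ f\end{bmatrix}=\begin{bmatrix}\widetilde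 x_0\\ f_*\end{bmatrix}$ and $U_1\begin{bmatrix}x_1\\ f_*\end{bmatrix}=\begin{bmatrix}\widetilde x_1\\ f\end{bmatrix}$. This is a well-defined operator whenever $I-D_1D_0$ is invertible, where $D_0,D_1$ are the lower right entries of $U_0,U_1$. Augmented input-output map: for a colligation $U=\begin{bmatrix}A&B\\ C&D\end{bmatrix}:\mathcal X\oplus\mathcal E\to\mathcal X\oplus\mathcal E_*$, $$\mathbf W(U)^+=\begin{bmatrix}W(U)_0^+&W(U)_2^+\\ W(U)_1^+&W(U)^+\end{bmatrix}:\begin{bmatrix}\mathcal X\\ \ell_{\mathcal E}(\mathbb Z_+)\end{bmatrix}\to\begin{bmatrix}\ell_{\mathcal X}(\mathbb Z_+)\\ \ell_{\mathcal E_*}(\mathbb Z_+)\end{bmatrix}$$ maps $(x(0),\vec e)$ to the $(\vec x,\vec e_* )$ generated by $x(n+1)=Ax(n)+Be(n)$, $e_*(n)=Cx(n)+De(n)$, $n\ge0$. Explicitly, $(W(U)_0^+x)(n)=A^nx$, $(W(U)_2^+\vec e)(n)=\sum_{k=0}^{n-1}A^{n-1-k}Be(k)$, $(W(U)_1^+x)(n)=CA^nx$, $(W(U)^+\vec e)(n)=De(n)+\sum_{k=0}^{n-1}CA^{n-1-k}Be(k)$. In $\mathcal F_\ell(\mathbf W(U_0)^+,\mathbf W(U_1)^+)$ the spaces eliminated are $\ell_{\mathcal D}(\mathbb Z_+)$ and $\ell_{\mathcal D_*}(\mathbb Z_+)$. *)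

theory Defs
  imports "HOL-Analysis.Product_Vector" "HOL-Library.Function_Algebras"
begin

text \<open>
  A linear space over a field \<open>'k\<close> is a type together with a scalar multiplication \<open>s\<close> satisfying
  \<^term>\<open>vector_space s\<close>; direct sums are product types with \<^const>\<open>module_prod.scale\<close>, and
  \<open>\<ell>\<^sub>G(\<int>\<^sub>+)\<close> is \<open>nat \<Rightarrow> 'g\<close>. Addition, subtraction and zero of sequences and of operators are
  pointwise.
\<close>

section \<open>Operator block matrices\<close>

definition blk11 :: "('a \<times> 'b::zero \<Rightarrow> 'c \<times> 'd) \<Rightarrow> 'a \<Rightarrow> 'c"
  where "blk11 T a = fst (T (a, 0))"

definition blk12 :: "('a::zero \<times> 'b \<Rightarrow> 'c \<times> 'd) \<Rightarrow> 'b \<Rightarrow> 'c"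
  where "blk12 T b = fst (T (0, b))"

definition blk21 :: "('a \<times> 'b::zero \<Rightarrow> 'c \<times> 'd) \<Rightarrow> 'a \<Rightarrow> 'd"
  where "blk21 T a = snd (T (a, 0))"

definition blk22 :: "('a::zero \<times> 'b \<Rightarrow> 'c \<times> 'd) \<Rightarrow> 'b \<Rightarrow> 'd"
  where "blk22 T b = snd (T (0, b))"

section \<open>Fourier representation operator\<close>

definition fourier_rep :: "('x \<Rightarrow> 'x) \<Rightarrow> 'x \<Rightarrow> nat \<Rightarrow> 'x"
  where "fourier_rep U x = (\<lambda>n. (U ^^ n) x)"

definition seq_split :: "(nat \<Rightarrow> 'a \<times> 'b) \<Rightarrow> (nat \<Rightarrow> 'a) \<times> (nat \<Rightarrow> 'b)"
  where "seq_split s = (fst \<circ> s, snd \<circ> s)"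

section \<open>Feedback connection\<close>

definition feedback_rel ::
  "('x0 \<times> 'f \<Rightarrow> 'y0 \<times> 'g) \<Rightarrow> ('x1 \<times> 'g \<Rightarrow> 'y1 \<times> 'f) \<Rightarrow> 'x0 \<times> 'x1 \<Rightarrow> 'y0 \<times> 'y1 \<Rightarrow> bool"
  where "feedback_rel U0 U1 x y \<longleftrightarrow>
    (\<exists>f g. U0 (fst x, f) = (fst y, g) \<and> U1 (snd x, g) = (snd y, f))"

definition feedback_well_defined ::
  "('x0 \<times> 'f \<Rightarrow> 'y0 \<times> 'g) \<Rightarrow> ('x1 \<times> 'g \<Rightarrow> 'y1 \<times> 'f) \<Rightarrow> bool"
  where "feedback_well_defined U0 U1 \<longleftrightarrow> (\<forall>x. \<exists>!y. feedback_rel U0 U1 x y)"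

text \<open>Meaningful only together with \<^const>\<open>feedback_well_defined\<close>.\<close>

definition feedback ::
  "('x0 \<times> 'f \<Rightarrow> 'y0 \<times> 'g) \<Rightarrow> ('x1 \<times> 'g \<Rightarrow> 'y1 \<times> 'f) \<Rightarrow> 'x0 \<times> 'x1 \<Rightarrow> 'y0 \<times> 'y1"
  where "feedback U0 U1 x = (THE y. feedback_rel U0 U1 x y)"

section \<open>Augmented input-output map of a colligation\<close>

primrec state_traj ::
  "('x \<times> 'e \<Rightarrow> 'x \<times> 'h) \<Rightarrow> 'x::ab_group_add \<Rightarrow> (nat \<Rightarrow> 'e::ab_group_add) \<Rightarrow> nat \<Rightarrow> 'x"
  where
    "state_traj U x e 0 = x"
  | "state_traj U x e (Suc n) = blk11 U (state_traj U x e n) + blk12 U (e n)"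

definition output_traj ::
  "('x \<times> 'e \<Rightarrow> 'x \<times> 'h) \<Rightarrow> 'x::ab_group_add \<Rightarrow> (nat \<Rightarrow> 'e::ab_group_add)
    \<Rightarrow> nat \<Rightarrow> 'h::ab_group_add"
  where "output_traj U x e n = blk21 U (state_traj U x e n) + blk22 U (e n)"

definition aug_io ::
  "('x::ab_group_add \<times> 'e::ab_group_add \<Rightarrow> 'x \<times> 'h::ab_group_add)
    \<Rightarrow> 'x \<times> (nat \<Rightarrow> 'e) \<Rightarrow> (nat \<Rightarrow> 'x) \<times> (nat \<Rightarrow> 'h)"
  where "aug_io U p = (state_traj U (fst p) (snd p), output_traj U (fst p) (snd p))"

text \<open>
  The entries of the augmented map; their closed forms, and the fact that they do represent the map
  as a block matrix, are \<open>W_closed_forms\<close> and \<open>aug_io_block\<close> below.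
\<close>

definition W0 ::
  "('x::ab_group_add \<times> 'e::ab_group_add \<Rightarrow> 'x \<times> 'h::ab_group_add) \<Rightarrow> 'x \<Rightarrow> nat \<Rightarrow> 'x"
  where "W0 U = blk11 (aug_io U)"

definition W1 ::
  "('x::ab_group_add \<times> 'e::ab_group_add \<Rightarrow> 'x \<times> 'h::ab_group_add) \<Rightarrow> 'x \<Rightarrow> nat \<Rightarrow> 'h"
  where "W1 U = blk21 (aug_io U)"

definition W2 ::
  "('x::ab_group_add \<times> 'e::ab_group_add \<Rightarrow> 'x \<times> 'h::ab_group_add) \<Rightarrow> (nat \<Rightarrow> 'e) \<Rightarrow> nat \<Rightarrow> 'x"
  where "W2 U = blk12 (aug_io U)"

definition W ::
  "('x::ab_group_add \<times> 'e::ab_group_add \<Rightarrow> 'x \<times> 'h::ab_group_add) \<Rightarrow> (nat \<Rightarrow> 'e) \<Rightarrow> nat \<Rightarrow> 'h"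
  where "W U = blk22 (aug_io U)"

lemma blk_additive:
  fixes T :: "'a::ab_group_add \<times> 'b::ab_group_add \<Rightarrow> 'c::ab_group_add \<times> 'd::ab_group_add"
  assumes "Modules.additive T"
  shows "Modules.additive (blk11 T)" "Modules.additive (blk12 T)"
    "Modules.additive (blk21 T)" "Modules.additive (blk22 T)"
proof -
  have a: "T (p + q) = T p + T q" for p q
    using assms by (rule additive.add)
  have "T (a + a', 0) = T (a, 0) + T (a', 0)" "T (0, b + b') = T (0, b) + T (0, b')" for a a' b b'
    using a[of "(a, 0)" "(a', 0)"] a[of "(0, b)" "(0, b')"] by simp_all
  then show "Modules.additive (blk11 T)" "Modules.additive (blk12 T)"
    "Modules.additive (blk21 T)" "Modules.additive (blk22 T)"
    by (simp_all add: additive_def blk11_def blk12_def blk21_def blk22_def)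
qed

lemma state_traj_closed_form:
  fixes U :: "'x::ab_group_add \<times> 'e::ab_group_add \<Rightarrow> 'x \<times> 'h::ab_group_add"
  assumes "Modules.additive U"
  shows "state_traj U x e n =
    (blk11 U ^^ n) x + (\<Sum>k<n. (blk11 U ^^ (n - 1 - k)) (blk12 U (e k)))"
proof (induction n)
  case 0
  show ?case by simp
next
  case (Suc n)
  note A = blk_additive(1)[OF assms]
  have "blk11 U (\<Sum>k<n. (blk11 U ^^ (n - 1 - k)) (blk12 U (e k)))
      = (\<Sum>k<n. (blk11 U ^^ Suc (n - 1 - k)) (blk12 U (e k)))"
    by (simp add: additive.sum[OF A])
  also have "\<dots> = (\<Sum>k<n. (blk11 U ^^ (n - k)) (blk12 U (e k)))"
    by (intro sum.cong refl) (simp add: Suc_diff_Suc del: funpow.simps)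
  finally show ?case
    by (simp add: Suc additive.add[OF A] add.assoc)
qed

lemma W_closed_forms:
  fixes U :: "'x::ab_group_add \<times> 'e::ab_group_add \<Rightarrow> 'x \<times> 'h::ab_group_add"
  assumes "Modules.additive U"
  shows "W0 U x n = (blk11 U ^^ n) x"
    and "W2 U e n = (\<Sum>k<n. (blk11 U ^^ (n - 1 - k)) (blk12 U (e k)))"
    and "W1 U x n = blk21 U ((blk11 U ^^ n) x)"
    and "W U e n = blk22 U (e n) + (\<Sum>k<n. blk21 U ((blk11 U ^^ (n - 1 - k)) (blk12 U (e k))))"
proof -
  note add = blk_additive[OF assms]
  have p: "(blk11 U ^^ m) 0 = 0" for m
    by (induction m) (simp_all add: additive.zero[OF add(1)])
  note z = p additive.zero[OF add(2)] additive.zero[OF add(3)] additive.zero[OF add(4)]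
  have s0: "state_traj U x (\<lambda>_. 0) n = (blk11 U ^^ n) x"
    by (simp add: state_traj_closed_form[OF assms] z)
  have se: "state_traj U 0 e n = (\<Sum>k<n. (blk11 U ^^ (n - 1 - k)) (blk12 U (e k)))"
    by (simp add: state_traj_closed_form[OF assms] z)
  show "W0 U x n = (blk11 U ^^ n) x"
    using s0 by (simp add: W0_def blk11_def[of "aug_io U"] aug_io_def zero_fun_def)
  show "W2 U e n = (\<Sum>k<n. (blk11 U ^^ (n - 1 - k)) (blk12 U (e k)))"
    using se by (simp add: W2_def blk12_def[of "aug_io U"] aug_io_def)
  show "W1 U x n = blk21 U ((blk11 U ^^ n) x)"
    using s0
    by (simp add: W1_def blk21_def[of "aug_io U"] aug_io_def output_traj_def zero_fun_def z)
  show "W U e n = blk22 U (e n) + (\<Sum>k<n. blk21 U ((blk11 U ^^ (n - 1 - k)) (blk12 U (e k))))"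
    using se
    by (simp add: W_def blk22_def[of "aug_io U"] aug_io_def output_traj_def
        additive.sum[OF add(3)] add.commute)
qed

lemma aug_io_block:
  fixes U :: "'x::ab_group_add \<times> 'e::ab_group_add \<Rightarrow> 'x \<times> 'h::ab_group_add"
  assumes "Modules.additive U"
  shows "aug_io U (x, e) = (W0 U x + W2 U e, W1 U x + W U e)"
proof -
  note add = blk_additive[OF assms]
  have "state_traj U x e n = (W0 U x + W2 U e) n" for n
    by (simp add: state_traj_closed_form[OF assms] W_closed_forms[OF assms])
  moreover have "output_traj U x e n = (W1 U x + W U e) n" for n
    by (simp add: output_traj_def state_traj_closed_form[OF assms] W_closed_forms[OF assms]
        additive.add[OF add(3)] additive.sum[OF add(3)] algebra_simps)
  ultimately show ?thesis
    by (auto simp: aug_io_def)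
qed

end

theory Submission
  imports Defs
begin

text \<open>
  Splicing the one-step feedback identities along an orbit of \<open>U\<close> shows that the orbit solves the
  trajectory-level feedback equations, and these have a unique solution because \<open>W U1 \<circ> W U0\<close> is
  causal with instantaneous part \<open>D1 \<circ> D0\<close>: inverting \<open>id - D1 \<circ> D0\<close> at each time determines the
  signal recursively. The block formulas are then the ones valid for any feedback connection of
  additive block operators.
\<close>

section \<open>Feedback connections of additive operators\<close>

lemma additive_split:
  fixes T :: "'a::ab_group_add \<times> 'b::ab_group_add \<Rightarrow> 'c::ab_group_add \<times> 'd::ab_group_add"
  assumes "Modules.additive T"
  shows "T (a, b) = (blk11 T a + blk12 T b, blk21 T a + blk22 T b)"
proof -
  have "T ((a, 0) + (0, b)) = T (a, 0) + T (0, b)"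
    using assms by (rule additive.add)
  then show ?thesis
    by (simp add: blk11_def blk12_def blk21_def blk22_def prod_eq_iff)
qed

text \<open>The inverse is explicit: \<open>id + P \<circ> R \<circ> Q\<close> with \<open>R\<close>
  the inverse of \<open>id - (Q \<circ> P)\<close>. It supplies the inverses in the lower blocks
  from the single hypothesis on \<open>id - (Q \<circ> P)\<close>.\<close>

lemma bij_id_minus_comp_swap:
  fixes P :: "'a::ab_group_add \<Rightarrow> 'b::ab_group_add" and Q :: "'b \<Rightarrow> 'a"
  assumes "Modules.additive P" "Modules.additive Q" "bij (id - (Q \<circ> P))"
  shows "bij (id - (P \<circ> Q))"
proof -
  define R where "R = inv (id - (Q \<circ> P))"
  have R: "R a - Q (P (R a)) = a" "R (a - Q (P a)) = a" for a
    using surj_f_inv_f[OF bij_is_surj[OF assms(3)], of a] inv_f_f[OF bij_is_inj[OF assms(3)], of a]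
    by (simp_all add: R_def)
  have eq: "R (Q b - Q (P (Q b))) = Q b" "Q (P (R (Q b))) = R (Q b) - Q b" for b
    using R(1)[of "Q b"] R(2)[of "Q b"] by (simp_all add: algebra_simps)
  show ?thesis
  proof (rule o_bij)
    show "(\<lambda>b. b + P (R (Q b))) \<circ> (id - (P \<circ> Q)) = id"
      by (rule ext) (simp add: additive.diff[OF assms(2)] eq)
    show "(id - (P \<circ> Q)) \<circ> (\<lambda>b. b + P (R (Q b))) = id"
      by (rule ext)
        (simp add: additive.add[OF assms(2)] additive.add[OF assms(1)] additive.diff[OF assms(1)] eq)
  qed
qed

text \<open>Eliminating the second internal signal leaves
  \<open>f' - D1 (D0 f') = D1 (C0 x0) + C1 x1\<close>, where \<open>C\<close> and \<open>D\<close>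
  stand for the \<open>blk21\<close> and \<open>blk22\<close> entries. Bijectivity of
  \<open>id - D1 \<circ> D0\<close> makes \<open>f x\<close> its only solution, so existence,
  uniqueness and the block formulas all come from this equivalence.\<close>

lemma feedback_rel_iff:
  fixes T0 :: "'x0::ab_group_add \<times> 'f::ab_group_add \<Rightarrow> 'y0::ab_group_add \<times> 'g::ab_group_add"
    and T1 :: "'x1::ab_group_add \<times> 'g \<Rightarrow> 'y1::ab_group_add \<times> 'f"
  assumes add: "Modules.additive T0" "Modules.additive T1"
    and bij: "bij (id - (blk22 T1 \<circ> blk22 T0))"
  defines "R \<equiv> inv (id - (blk22 T1 \<circ> blk22 T0))"
  defines "f \<equiv> \<lambda>x. R (blk22 T1 (blk21 T0 (fst x)) + blk21 T1 (snd x))"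
  defines "g \<equiv> \<lambda>x. blk21 T0 (fst x) + blk22 T0 (f x)"
  shows "feedback_rel T0 T1 x y \<longleftrightarrow>
    y = (blk11 T0 (fst x) + blk12 T0 (f x), blk11 T1 (snd x) + blk12 T1 (g x))"
proof -
  note D1 = additive.add[OF blk_additive(4)[OF add(2)]]
  have R: "f' - blk22 T1 (blk22 T0 f') = a \<longleftrightarrow> f' = R a" for f' a
    using bij_inv_eq_iff[OF bij, of f' a] by (auto simp: R_def)
  have "blk21 T1 (snd x) + blk22 T1 (blk21 T0 (fst x) + blk22 T0 f') = f' \<longleftrightarrow> f' = f x" for f'
    unfolding f_def R[symmetric] by (auto simp: D1 algebra_simps)
  then show ?thesis
    by (auto simp: feedback_rel_def additive_split[OF add(1)] additive_split[OF add(2)]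
        prod_eq_iff g_def)
qed

lemma feedback_rel_swap:
  "feedback_rel T0 T1 (a, b) (c, d) \<longleftrightarrow> feedback_rel T1 T0 (b, a) (d, c)"
  by (auto simp: feedback_rel_def)

context
  fixes T0 :: "'x0::ab_group_add \<times> 'f::ab_group_add \<Rightarrow> 'y0::ab_group_add \<times> 'g::ab_group_add"
    and T1 :: "'x1::ab_group_add \<times> 'g \<Rightarrow> 'y1::ab_group_add \<times> 'f"
  assumes add: "Modules.additive T0" "Modules.additive T1"
    and bij: "bij (id - (blk22 T1 \<circ> blk22 T0))"
begin

lemma feedback_well_definedI: "feedback_well_defined T0 T1"
  by (simp add: feedback_well_defined_def feedback_rel_iff[OF add bij])

lemma feedback_eqI: "feedback_rel T0 T1 x y \<Longrightarrow> feedback T0 T1 x = y"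
  using feedback_well_definedI unfolding feedback_def feedback_well_defined_def
  by (blast intro: the1_equality)

lemma feedback_rel_feedback: "feedback_rel T0 T1 x (feedback T0 T1 x)"
  using feedback_well_definedI unfolding feedback_def feedback_well_defined_def
  by (blast intro: theI')

lemma feedback_upper_blocks:
  "blk11 (feedback T0 T1) =
    blk11 T0 + (blk12 T0 \<circ> inv (id - (blk22 T1 \<circ> blk22 T0)) \<circ> blk22 T1 \<circ> blk21 T0)"
  "blk12 (feedback T0 T1) = blk12 T0 \<circ> inv (id - (blk22 T1 \<circ> blk22 T0)) \<circ> blk21 T1"
proof -
  note z = additive.zero[OF blk_additive(1)[OF add(1)]] additive.zero[OF blk_additive(3)[OF add(1)]]
    additive.zero[OF blk_additive(3)[OF add(2)]] additive.zero[OF blk_additive(4)[OF add(2)]]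
  \<comment> \<open>This is the explicit value of the feedback operator; each block results from
    setting the other input to zero, where \<open>z\<close> removes the vanishing terms.\<close>
  note eq = feedback_rel_feedback[unfolded feedback_rel_iff[OF add bij]]
  show "blk11 (feedback T0 T1) =
    blk11 T0 + (blk12 T0 \<circ> inv (id - (blk22 T1 \<circ> blk22 T0)) \<circ> blk22 T1 \<circ> blk21 T0)"
    by (rule ext) (simp add: blk11_def[of "feedback T0 T1"] eq z)
  show "blk12 (feedback T0 T1) = blk12 T0 \<circ> inv (id - (blk22 T1 \<circ> blk22 T0)) \<circ> blk21 T1"
    by (rule ext) (simp add: blk12_def[of "feedback T0 T1"] eq z)
qed

end

text \<open>Interchanging the two operators turns lower blocks into upper blocks. The reversed
  connection is well posed by \<open>bij_id_minus_comp_swap\<close>.\<close>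

lemma feedback_lower_blocks:
  fixes T0 :: "'x0::ab_group_add \<times> 'f::ab_group_add \<Rightarrow> 'y0::ab_group_add \<times> 'g::ab_group_add"
    and T1 :: "'x1::ab_group_add \<times> 'g \<Rightarrow> 'y1::ab_group_add \<times> 'f"
  assumes add: "Modules.additive T0" "Modules.additive T1"
    and bij: "bij (id - (blk22 T1 \<circ> blk22 T0))"
  shows "blk21 (feedback T0 T1) = blk12 T1 \<circ> inv (id - (blk22 T0 \<circ> blk22 T1)) \<circ> blk21 T0"
    "blk22 (feedback T0 T1) =
      blk11 T1 + (blk12 T1 \<circ> inv (id - (blk22 T0 \<circ> blk22 T1)) \<circ> blk22 T0 \<circ> blk21 T1)"
proof -
  note bij' = bij_id_minus_comp_swap[OF blk_additive(4)[OF add(1)] blk_additive(4)[OF add(2)] bij]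
  have "feedback T0 T1 (a, b) = prod.swap (feedback T1 T0 (b, a))" for a b
    by (rule feedback_eqI[OF add bij])
      (metis add bij' feedback_rel_feedback feedback_rel_swap prod.swap_def surjective_pairing)
  then have "blk21 (feedback T0 T1) = blk12 (feedback T1 T0)"
    "blk22 (feedback T0 T1) = blk11 (feedback T1 T0)"
    by (auto simp: blk21_def blk12_def blk22_def blk11_def)
  then show "blk21 (feedback T0 T1) = blk12 T1 \<circ> inv (id - (blk22 T0 \<circ> blk22 T1)) \<circ> blk21 T0"
    "blk22 (feedback T0 T1) =
      blk11 T1 + (blk12 T1 \<circ> inv (id - (blk22 T0 \<circ> blk22 T1)) \<circ> blk22 T0 \<circ> blk21 T1)"
    by (simp_all add: feedback_upper_blocks[OF add(2,1) bij'])
qed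

lemma linear_additive: "Vector_Spaces.linear s t T \<Longrightarrow> Modules.additive T"
  by (simp add: Vector_Spaces.linear_iff additive_def)

lemma vector_space_module_prod_scale:
  assumes "vector_space s" "vector_space t"
  shows "vector_space (module_prod.scale s t)"
proof -
  interpret vector_space_prod s t
    using assms by (simp add: vector_space_prod_def vector_space_pair_def)
  show ?thesis
    by unfold_locales
qed

text \<open>Sums and multiples of internal signals are internal signals for the corresponding sums
  and multiples of inputs and outputs; uniqueness of the output then gives linearity without the
  explicit formula.\<close>

lemma linear_feedback:
  fixes s0 :: "'k::field \<Rightarrow> 'x0::ab_group_add \<Rightarrow> 'x0" and s1 :: "'k \<Rightarrow> 'x1::ab_group_add \<Rightarrow> 'x1"
    and t0 :: "'k \<Rightarrow> 'y0::ab_group_add \<Rightarrow> 'y0" and t1 :: "'k \<Rightarrow> 'y1::ab_group_add \<Rightarrow> 'y1"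
    and sf :: "'k \<Rightarrow> 'f::ab_group_add \<Rightarrow> 'f" and sg :: "'k \<Rightarrow> 'g::ab_group_add \<Rightarrow> 'g"
  assumes vs: "vector_space s0" "vector_space s1" "vector_space t0" "vector_space t1"
      "vector_space sf" "vector_space sg"
    and lin: "Vector_Spaces.linear (module_prod.scale s0 sf) (module_prod.scale t0 sg) T0"
      "Vector_Spaces.linear (module_prod.scale s1 sg) (module_prod.scale t1 sf) T1"
    and bij: "bij (id - (blk22 T1 \<circ> blk22 T0))"
  shows "Vector_Spaces.linear (module_prod.scale s0 s1) (module_prod.scale t0 t1) (feedback T0 T1)"
proof -
  have scale: "module_prod.scale s t c p = (s c (fst p), t c (snd p))"
    if "vector_space s" "vector_space t"
    for s :: "'k \<Rightarrow> 'a::ab_group_add \<Rightarrow> 'a" and t :: "'k \<Rightarrow> 'b::ab_group_add \<Rightarrow> 'b" and c p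
    using that by (simp add: module_prod.scale_def module_prod_def module_pair_def module_iff_vector_space)
  note add = lin[THEN linear_additive]
  note hom = lin[unfolded Vector_Spaces.linear_def, THEN conjunct2, THEN conjunct2, THEN module_hom.scale]
  have add': "feedback T0 T1 (x + y) = feedback T0 T1 x + feedback T0 T1 y" for x y
  proof (rule feedback_eqI[OF add bij])
    obtain f g f' g' where
      "T0 (fst x, f) = (fst (feedback T0 T1 x), g)" "T1 (snd x, g) = (snd (feedback T0 T1 x), f)"
      "T0 (fst y, f') = (fst (feedback T0 T1 y), g')" "T1 (snd y, g') = (snd (feedback T0 T1 y), f')"
      using feedback_rel_feedback[OF add bij, of x] feedback_rel_feedback[OF add bij, of y]
      unfolding feedback_rel_def by blast
    then show "feedback_rel T0 T1 (x + y) (feedback T0 T1 x + feedback T0 T1 y)"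
      using additive.add[OF add(1), of "(fst x, f)" "(fst y, f')"]
        additive.add[OF add(2), of "(snd x, g)" "(snd y, g')"]
      by (auto simp: feedback_rel_def)
  qed
  have scale': "feedback T0 T1 (module_prod.scale s0 s1 c x) =
      module_prod.scale t0 t1 c (feedback T0 T1 x)" for c x
  proof (rule feedback_eqI[OF add bij])
    obtain f g where
      "T0 (fst x, f) = (fst (feedback T0 T1 x), g)" "T1 (snd x, g) = (snd (feedback T0 T1 x), f)"
      using feedback_rel_feedback[OF add bij, of x] unfolding feedback_rel_def by blast
    then show "feedback_rel T0 T1 (module_prod.scale s0 s1 c x)
        (module_prod.scale t0 t1 c (feedback T0 T1 x))"
      using hom(1)[of c "(fst x, f)"] hom(2)[of c "(snd x, g)"]
      by (auto simp: feedback_rel_def scale vs)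
  qed
  show ?thesis
    using vs add' scale'
    by (simp add: Vector_Spaces.linear_iff vector_space_module_prod_scale)
qed

section \<open>Causality of the input-output map\<close>

lemma state_traj_cong:
  "(\<And>k. k < n \<Longrightarrow> e k = e' k) \<Longrightarrow> state_traj U x e n = state_traj U x e' n"
  by (induction n) auto

text \<open>Read at time \<open>n\<close>, the equation \<open>(id - P) e = g\<close> says
  \<open>(id - D) (e n) = g n + h e n\<close>. Since \<open>h e n\<close> involves only earlier
  values of \<open>e\<close>, the equation determines \<open>e n\<close> recursively.\<close>

lemma bij_id_minus_causal:
  fixes P h :: "(nat \<Rightarrow> 'e::ab_group_add) \<Rightarrow> nat \<Rightarrow> 'e"
  assumes P: "\<And>e n. P e n = D (e n) + h e n"
    and h: "\<And>e e' n. (\<And>k. k < n \<Longrightarrow> e k = e' k) \<Longrightarrow> h e n = h e' n"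
    and D: "bij (id - D)"
  shows "bij (id - P)"
proof (rule bijI)
  show "inj (id - P)"
  proof (rule injI)
    fix e e'
    assume eq: "(id - P) e = (id - P) e'"
    have "e n = e' n" for n
    proof (induction n rule: less_induct)
      case (less n)
      have "e n - (D (e n) + h e n) = e' n - (D (e' n) + h e' n)"
        using fun_cong[OF eq, of n] by (simp add: P)
      \<comment> \<open>By the induction hypothesis the two strictly causal terms coincide and
        cancel.\<close>
      then have "(id - D) (e n) = (id - D) (e' n)"
        using h[of n e e'] less by (simp add: algebra_simps)
      then show ?case
        by (rule injD[OF bij_is_inj[OF D]])
    qed
    then show "e = e'"
      by (rule ext)
  qed
  show "surj (id - P)"
    unfolding surj_def
  proof
    fix g
    have "\<exists>e. \<forall>n. (id - D) (e n) = g n + h e n"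
    \<comment> \<open>Choice along the well-founded order of times builds \<open>e\<close>: the
      condition on its value at \<open>n\<close> depends only on earlier values, and surjectivity of
      \<open>id - D\<close> makes it satisfiable.\<close>
    proof (rule dependent_wf_choice[OF wf_less])
      show "((id - D) r = g n + h e n) = ((id - D) r = g n + h e' n)"
        if "\<And>k. (k, n) \<in> {(x, y). x < y} \<Longrightarrow> e k = e' k" for e e' n r
        using h[of n e e'] that by simp
      show "\<exists>r. (id - D) r = g n + h e n" for n e
        using surjD[OF bij_is_surj[OF D], of "g n + h e n"] by (auto simp: eq_commute)
    qed
    then obtain e where "\<And>n. (id - D) (e n) = g n + h e n"
      by blast
    then have "g = (id - P) e"
      by (intro ext) (simp add: P algebra_simps)
    then show "\<exists>e. g = (id - P) e"
      by blast
  qed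
qed

lemma W_output: "W U e n = blk21 U (state_traj U 0 e n) + blk22 U (e n)"
  by (simp add: W_def blk22_def[of "aug_io U"] aug_io_def output_traj_def)

text \<open>Time \<open>n\<close> itself is included because of the feedthrough term
  \<open>blk22 U (e n)\<close>; the state at time \<open>n\<close> reads only strictly earlier
  inputs.\<close>

lemma W_cong: "(\<And>k. k \<le> n \<Longrightarrow> e k = e' k) \<Longrightarrow> W U e n = W U e' n"
  using state_traj_cong[of n e e' U 0] by (simp add: W_output)

lemma bij_id_minus_W_comp_W:
  fixes U0 :: "'x0::ab_group_add \<times> 'd::ab_group_add \<Rightarrow> 'x0 \<times> 'ds::ab_group_add"
    and U1 :: "'x1::ab_group_add \<times> 'ds \<Rightarrow> 'x1 \<times> 'd"
  assumes "Modules.additive U1" "bij (id - (blk22 U1 \<circ> blk22 U0))"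
  shows "bij (id - (W U1 \<circ> W U0))"
proof (rule bij_id_minus_causal[OF _ _ assms(2)])
  \<comment> \<open>Everything in the composite output except \<open>D1 (D0 (e n))\<close>: the
    contribution of the state of \<open>U1\<close>, and that of the state of \<open>U0\<close>
    passed through the feedthrough of \<open>U1\<close>.\<close>
  let ?h = "\<lambda>e n. blk21 U1 (state_traj U1 0 (W U0 e) n) + blk22 U1 (blk21 U0 (state_traj U0 0 e n))"
  show "(W U1 \<circ> W U0) e n = (blk22 U1 \<circ> blk22 U0) (e n) + ?h e n" for e n
    by (simp add: W_output[of U1] W_output[of U0 e n] additive.add[OF blk_additive(4)[OF assms(1)]]
        algebra_simps)
  show "?h e n = ?h e' n" if eq: "\<And>k. k < n \<Longrightarrow> e k = e' k" for e e' n
  proof -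
    \<comment> \<open>Agreement strictly before \<open>n\<close> suffices here, since the state of
      \<open>U1\<close> at time \<open>n\<close> reads \<open>W U0 e\<close> only at times
      \<open>k < n\<close>.\<close>
    have "W U0 e k = W U0 e' k" if "k < n" for k
      by (rule W_cong) (use that eq in simp)
    then show ?thesis
      using eq state_traj_cong[of n e e' U0 0]
        state_traj_cong[of n "W U0 e" "W U0 e'" U1 0] by simp
  qed
qed

section \<open>Trajectories of the feedback connection\<close>

lemma state_traj_add:
  assumes "Modules.additive U"
  shows "state_traj U (x + x') (e + e') n = state_traj U x e n + state_traj U x' e' n"
  by (induction n)
    (simp_all add: additive.add[OF blk_additive(1)[OF assms]]
      additive.add[OF blk_additive(2)[OF assms]] algebra_simps)

lemma additive_aug_io:
  assumes "Modules.additive U"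
  shows "Modules.additive (aug_io U)"
proof -
  have "output_traj U (x + x') (e + e') n = output_traj U x e n + output_traj U x' e' n" for x x' e e' n
    by (simp add: output_traj_def state_traj_add[OF assms] additive.add[OF blk_additive(3)[OF assms]]
        additive.add[OF blk_additive(4)[OF assms]] algebra_simps)
  then show ?thesis
    by (auto simp: additive_def aug_io_def state_traj_add[OF assms])
qed

text \<open>The initial state and the input determine a trajectory, so sequences obeying the
  one-step equations must be the one that \<open>aug_io\<close> generates.\<close>

lemma aug_io_eqI:
  assumes "Modules.additive U" and "\<And>n. U (x n, e n) = (x (Suc n), y n)"
  shows "aug_io U (x 0, e) = (x, y)"
proof -
  have step: "blk11 U (x n) + blk12 U (e n) = x (Suc n)" "blk21 U (x n) + blk22 U (e n) = y n" for n
    using assms(2)[of n] by (simp_all add: additive_split[OF assms(1)])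
  have x: "state_traj U (x 0) e n = x n" for n
    by (induction n) (simp_all add: step)
  then show ?thesis
    by (auto simp: aug_io_def output_traj_def step)
qed

lemma feedback_rel_aug_io:
  assumes "Modules.additive U0" "Modules.additive U1"
    and rel: "\<And>n. feedback_rel U0 U1 (z n) (z (Suc n))"
  shows "feedback_rel (aug_io U0) (aug_io U1) (z 0) (seq_split z)"
proof -
  \<comment> \<open>Internal signals exist separately at each time; choosing a pair for every
    \<open>n\<close> assembles them into sequences.\<close>
  obtain f g where "\<And>n. U0 (fst (z n), f n) = (fst (z (Suc n)), g n)"
    "\<And>n. U1 (snd (z n), g n) = (snd (z (Suc n)), f n)"
    using rel unfolding feedback_rel_def by metis
  then have "aug_io U0 ((fst \<circ> z) 0, f) = (fst \<circ> z, g)" "aug_io U1 ((snd \<circ> z) 0, g) = (snd \<circ> z, f)"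
    by (intro aug_io_eqI assms(1,2); simp)+
  then show ?thesis
    by (auto simp: feedback_rel_def seq_split_def)
qed


theorem theorem2p3:
  fixes s0 :: "'k::field \<Rightarrow> 'x0::ab_group_add \<Rightarrow> 'x0"
    and s1 :: "'k \<Rightarrow> 'x1::ab_group_add \<Rightarrow> 'x1"
    and sD :: "'k \<Rightarrow> 'd::ab_group_add \<Rightarrow> 'd"
    and sDs :: "'k \<Rightarrow> 'ds::ab_group_add \<Rightarrow> 'ds"
    and U0 :: "'x0 \<times> 'd \<Rightarrow> 'x0 \<times> 'ds"
    and U1 :: "'x1 \<times> 'ds \<Rightarrow> 'x1 \<times> 'd"
    and U :: "'x0 \<times> 'x1 \<Rightarrow> 'x0 \<times> 'x1"
    and L :: "'x0 \<times> 'x1 \<Rightarrow> (nat \<Rightarrow> 'x0) \<times> (nat \<Rightarrow> 'x1)"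
  assumes "vector_space s0" "vector_space s1" "vector_space sD" "vector_space sDs"
    and "Vector_Spaces.linear (module_prod.scale s0 sD) (module_prod.scale s0 sDs) U0"
    and "Vector_Spaces.linear (module_prod.scale s1 sDs) (module_prod.scale s1 sD) U1"
    and "bij (id - (blk22 U1 \<circ> blk22 U0))"
    and "U = feedback U0 U1"
    and "L = seq_split \<circ> fourier_rep U"
  shows "feedback_well_defined U0 U1
    \<and> Vector_Spaces.linear (module_prod.scale s0 s1) (module_prod.scale s0 s1) U
    \<and> feedback_well_defined (aug_io U0) (aug_io U1)
    \<and> L = feedback (aug_io U0) (aug_io U1)
    \<and> bij (id - (W U1 \<circ> W U0))
    \<and> bij (id - (W U0 \<circ> W U1))
    \<and> blk11 L = W0 U0 + (W2 U0 \<circ> inv (id - (W U1 \<circ> W U0)) \<circ> W U1 \<circ> W1 U0)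
    \<and> blk12 L = W2 U0 \<circ> inv (id - (W U1 \<circ> W U0)) \<circ> W1 U1
    \<and> blk21 L = W2 U1 \<circ> inv (id - (W U0 \<circ> W U1)) \<circ> W1 U0
    \<and> blk22 L = W0 U1 + (W2 U1 \<circ> inv (id - (W U0 \<circ> W U1)) \<circ> W U0 \<circ> W1 U1)"
proof -
  note add = assms(5,6)[THEN linear_additive]
  note aug = add[THEN additive_aug_io]
  note bij = assms(7)
  have bijW: "bij (id - (W U1 \<circ> W U0))"
    by (rule bij_id_minus_W_comp_W[OF add(2) bij])
  \<comment> \<open>\<open>W\<close> is by definition the \<open>blk22\<close> entry of
    \<open>aug_io\<close>, so this is the well-posedness condition for the trajectory-level
    connection.\<close>
  note bijW' = bijW[unfolded W_def]
  have L: "L = feedback (aug_io U0) (aug_io U1)"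
  proof
    fix x
    have "feedback_rel U0 U1 ((U ^^ n) x) ((U ^^ Suc n) x)" for n
      using feedback_rel_feedback[OF add bij] by (simp add: assms(8))
    \<comment> \<open>The sequence is the orbit of \<open>x\<close> under \<open>U\<close>: it
      starts at \<open>x\<close>, and its split form is \<open>L x\<close>.\<close>
    from feedback_rel_aug_io[where z = "\<lambda>n. (U ^^ n) x", OF add this]
    have "feedback_rel (aug_io U0) (aug_io U1) x (L x)"
      by (simp add: assms(9) fourier_rep_def)
    then show "L x = feedback (aug_io U0) (aug_io U1) x"
      using feedback_eqI[OF aug bijW'] by simp
  qed
  moreover have "bij (id - (W U0 \<circ> W U1))"
    using bij_id_minus_comp_swap[OF blk_additive(4)[OF aug(1)] blk_additive(4)[OF aug(2)] bijW']
    by (simp add: W_def)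
  moreover have "Vector_Spaces.linear (module_prod.scale s0 s1) (module_prod.scale s0 s1) U"
    unfolding assms(8) by (rule linear_feedback) (use assms in simp_all)
  ultimately show ?thesis
    using bijW feedback_well_definedI[OF add bij] feedback_well_definedI[OF aug bijW']
      feedback_upper_blocks[OF aug bijW'] feedback_lower_blocks[OF aug bijW']
    by (simp add: W_def W0_def W1_def W2_def)
qed

end
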